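(* Let $\lambda>0$, let $\mu,\nu\in P_2(\mathbb{R}^d)$ be absolutely continuous with respect to Lebesgue measure with non-negative densities $f$ and $g$, and let $\varphi:\mathbb{R}^d\to\mathbb{R}$ be such that $(\mu,\nu,\varphi)$ is $\lambda$-regular; let $T=\nabla\varphi$ be the optimal transport map from $\mu$ to $\nu$. Let $Y=\{y\in\mathbb{R}^d: g(y)>0\}$ and let $X\subset\mathbb{R}^d$ be a Borel set on which $\mu$ is concentrated. Let $\mu_h=\sum_{i=1}^N f_i\delta_{x_i}$ be a probability measure with distinct nodes $x_1,\dots,x_N\in X$ and $f_i>0$ for all $i$. Let $\varphi_h=(\varphi_h(x_i))_{i=1}^N\in\mathbb{R}^N$ be a nodal function solving the semi-discrete problem $$\nu(F_i)=f_i,\qquad F_i:=\partial\varphi_h(x_i)\cap Y,\qquad i=1,\dots,N,$$ and let $\gamma_h=(S_h,\mathrm{id})_\#\nu$ be the corresponding semi-discrete optimal plan. Then $$\int_{X\times Y}|T(x)-y|^2\,d\gamma_h(x,y)=\sum_{i=1}^N\int_{F_i}|T(x_i)-y|^2g(y)\,dy\le E_h^2,$$ where $$E_h:=2\lambda^{1/2}\,W_2(\mu,\mu_h)^{1/2}\big(W_2(\mu,\nu)+W_2(\mu,\mu_h)\big)^{1/2}+\lambda W_2(\mu,\mu_h).$$ Moreover, there exists a constant $C$ depending only on $(\mu,\nu)$ such that, whenever $0<h\le\lambda^{-1}$ and $\mu_h$ satisfies $W_2(\mu,\mu_h)\le h$, $$\int_{X\times Y}|T(x)-y|^2\,d\gamma_h(x,y)=\sum_{i=1}^N\int_{F_i}|T(x_i)-y|^2g(y)\,dy\le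 C\lambda h.$$
   Context: $P_2(\mathbb{R}^d)$ is the set of Borel probability measures on $\mathbb{R}^d$ with finite second moment. $W_2(\mu,\nu)=\big(\min_{\gamma}\int|x-y|^2\,d\gamma(x,y)\big)^{1/2}$, the minimum being over all couplings (transport plans) $\gamma$ of $\mu$ and $\nu$, is the quadratic Wasserstein distance. A map $T$ is an optimal transport map from $\mu$ to $\nu$ if $T_\#\mu=\nu$ and $T$ minimizes $\int|x-S(x)|^2\,d\mu(x)$ among all measurable maps $S$ with $S_\#\mu=\nu$. $\lambda$-regularity: $(\mu,\nu,\varphi)$ is $\lambda$-regular ($\lambda>0$) if $\varphi:\mathbb{R}^d\to\mathbb{R}$ is convex, $\nabla\varphi$ is the optimal transport map from $\mu$ to $\nu$ (for the quadratic cost), and $\varphi$ is $\lambda$-smooth, meaning $$\varphi((1-t)x_0+tx_1)+\frac{t(1-t)\lambda}{2}|x_0-x_1|^2\ge(1-t)\varphi(x_0)+t\varphi(x_1)$$ for all $x_0,x_1\in\mathbb{R}^d$, $t\in[0,1]$; equivalently, $\frac{\lambda}{2}|x|^2-\varphi(x)$ is convex. (Such a $\varphi$ is differentiable everywhere, so $T=\nabla\varphi$ is defined on all of $\mathbb{R}^d$.) Discrete subdifferential: for a nodal function $\varphi_h:\{x_1,\dots,x_N\}\to\mathbb{R}$, $$\partial\varphi_h(x_i):=\{y\in\mathbb{R}^d:\ \varphi_h(x_i)+(x_j-x_i)\cdot y\le\varphi_h(x_j)\ \ \forall j=1,\dots,N\}.$$ The sets $F_i=\partial\varphi_h(x_i)\cap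 Y$ (Laguerre cells) cover $Y$ and overlap pairwise only in Lebesgue-null sets. The map $S_h$ is defined ($\nu$-a.e.) by $S_h(y):=x_i$ for a.e. $y\in F_i$; it is the optimal transport map from $\nu$ to $\mu_h$, and $\gamma_h:=(S_h,\mathrm{id})_\#\nu$, i.e. $\gamma_h(E)=\nu\{y\in Y:(S_h(y),y)\in E\}$ for Borel $E\subset X\times Y$, is the induced optimal transport plan between $\mu_h$ and $\nu$. *)

theory Defs
  imports "HOL-Probability.Probability"
begin

section \<open>Quadratic optimal transport\<close>

definition P2 :: "'a::euclidean_space measure set" where
  "P2 = {\<mu>. prob_space \<mu> \<and> sets \<mu> = sets borel \<and>
             (\<integral>\<^sup>+ x. ennreal ((norm x)\<^sup>2) \<partial>\<mu>) < \<infinity>}"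

definition has_lebesgue_density :: "'a::euclidean_space measure \<Rightarrow> ('a \<Rightarrow> real) \<Rightarrow> bool" where
  "has_lebesgue_density \<mu> f \<longleftrightarrow>
     f \<in> borel_measurable borel \<and> (\<forall>x. 0 \<le> f x) \<and> \<mu> = density lborel (\<lambda>x. ennreal (f x))"

definition couplings ::
  "'a::euclidean_space measure \<Rightarrow> 'a measure \<Rightarrow> ('a \<times> 'a) measure set" where
  "couplings \<mu> \<nu> = {\<gamma>. sets \<gamma> = sets (borel \<Otimes>\<^sub>M borel) \<and>
                      distr \<gamma> borel fst = \<mu> \<and> distr \<gamma> borel snd = \<nu>}"

text \<open>The infimum is attained, so it is the usual minimum.  On \<open>P2\<close> it is finite, so that
  \<^const>\<open>enn2real\<close> (which sends \<open>\<infinity>\<close> to 0) loses nothing; outside \<open>P2\<close> the value is meaningless.\<close>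

definition W2 :: "'a::euclidean_space measure \<Rightarrow> 'a measure \<Rightarrow> real" where
  "W2 \<mu> \<nu> = sqrt (enn2real
     (INF \<gamma>\<in>couplings \<mu> \<nu>. \<integral>\<^sup>+ p. ennreal ((norm (fst p - snd p))\<^sup>2) \<partial>\<gamma>))"

definition transport_maps ::
  "'a::euclidean_space measure \<Rightarrow> 'a measure \<Rightarrow> ('a \<Rightarrow> 'a) set" where
  "transport_maps \<mu> \<nu> = {S \<in> borel_measurable borel. distr \<mu> borel S = \<nu>}"

definition optimal_transport_map ::
  "'a::euclidean_space measure \<Rightarrow> 'a measure \<Rightarrow> ('a \<Rightarrow> 'a) \<Rightarrow> bool" where
  "optimal_transport_map \<mu> \<nu> T \<longleftrightarrow>
     T \<in> transport_maps \<mu> \<nu> \<and>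
     (\<forall>S\<in>transport_maps \<mu> \<nu>.
        (\<integral>\<^sup>+ x. ennreal ((norm (x - T x))\<^sup>2) \<partial>\<mu>) \<le> (\<integral>\<^sup>+ x. ennreal ((norm (x - S x))\<^sup>2) \<partial>\<mu>))"

section \<open>Regularity\<close>

text \<open>Unspecified where \<open>\<phi>\<close> is not differentiable; convex functions that are
  \<open>smooth_fun\<close> below are differentiable everywhere.\<close>

definition grad :: "('a::euclidean_space \<Rightarrow> real) \<Rightarrow> 'a \<Rightarrow> 'a" where
  "grad \<phi> x = (THE D. GDERIV \<phi> x :> D)"

lemma grad_eqI:
  assumes "GDERIV \<phi> x :> D"
  shows "grad \<phi> x = D"
  unfolding grad_def
proof (rule the_equality)
  fix E assume "GDERIV \<phi> x :> E"
  then have "(\<lambda>h. h \<bullet> E) = (\<lambda>h. h \<bullet> D)"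
    using assms unfolding gderiv_def by (rule has_derivative_unique)
  then show "E = D"
    unfolding fun_eq_iff by (simp only: vector_eq_ldot)
qed (fact assms)

definition smooth_fun :: "real \<Rightarrow> ('a::euclidean_space \<Rightarrow> real) \<Rightarrow> bool" where
  "smooth_fun lam \<phi> \<longleftrightarrow>
     (\<forall>x0 x1. \<forall>t\<in>{0..1}.
        \<phi> ((1 - t) *\<^sub>R x0 + t *\<^sub>R x1) + t * (1 - t) * lam / 2 * (norm (x0 - x1))\<^sup>2
          \<ge> (1 - t) * \<phi> x0 + t * \<phi> x1)"

definition regular ::
  "real \<Rightarrow> 'a::euclidean_space measure \<Rightarrow> 'a measure \<Rightarrow> ('a \<Rightarrow> real) \<Rightarrow> bool" where
  "regular lam \<mu> \<nu> \<phi> \<longleftrightarrow>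
     convex_on UNIV \<phi> \<and> optimal_transport_map \<mu> \<nu> (grad \<phi>) \<and> smooth_fun lam \<phi>"

section \<open>The semi-discrete problem\<close>

text \<open>The measure \<open>\<Sum>i=1..N. w i * \<delta>(x i)\<close>, as the image of the weighted counting measure on
  the indices; compare \<open>emeasure_discrete_measure\<close>.\<close>

definition discrete_measure ::
  "nat \<Rightarrow> (nat \<Rightarrow> real) \<Rightarrow> (nat \<Rightarrow> 'a::euclidean_space) \<Rightarrow> 'a measure" where
  "discrete_measure N w x = distr (point_measure {1..N} (\<lambda>i. ennreal (w i))) borel x"

lemma emeasure_discrete_measure:
  assumes "A \<in> sets borel"
  shows "emeasure (discrete_measure N w x) A = (\<Sum>i=1..N. ennreal (w i) * indicator A (x i))"
proof -
  have "emeasure (discrete_measure N w x) A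
      = emeasure (point_measure {1..N} (\<lambda>i. ennreal (w i))) (x -` A \<inter> {1..N})"
    unfolding discrete_measure_def
    by (subst emeasure_distr) (use assms in \<open>auto simp: space_point_measure\<close>)
  also have "\<dots> = (\<Sum>i\<in>x -` A \<inter> {1..N}. ennreal (w i))"
    by (rule emeasure_point_measure_finite) auto
  also have "\<dots> = (\<Sum>i=1..N. ennreal (w i) * indicator A (x i))"
    by (rule sum.mono_neutral_cong_left) (auto simp: indicator_def)
  finally show ?thesis .
qed

text \<open>A nodal function is a function on the whole space of which only the values on the node
  set \<open>P\<close> are used.\<close>

definition discrete_subdiff ::
  "'a::euclidean_space set \<Rightarrow> ('a \<Rightarrow> real) \<Rightarrow> 'a \<Rightarrow> 'a set" where
  "discrete_subdiff P \<phi>h p = {y. \<forall>q\<in>P. \<phi>h p + (q - p) \<bullet> y \<le> \<phi>h q}"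

definition laguerre_cell ::
  "'a::euclidean_space set \<Rightarrow> nat \<Rightarrow> (nat \<Rightarrow> 'a) \<Rightarrow> ('a \<Rightarrow> real) \<Rightarrow> nat \<Rightarrow> 'a set" where
  "laguerre_cell Y N x \<phi>h i = discrete_subdiff (x ` {1..N}) \<phi>h (x i) \<inter> Y"

definition semidiscrete_map ::
  "'a::euclidean_space measure \<Rightarrow> 'a set \<Rightarrow> nat \<Rightarrow> (nat \<Rightarrow> 'a) \<Rightarrow> ('a \<Rightarrow> real) \<Rightarrow> ('a \<Rightarrow> 'a) \<Rightarrow> bool"
  where
  "semidiscrete_map \<nu> Y N x \<phi>h S \<longleftrightarrow>
     S \<in> borel_measurable borel \<and>
     (\<forall>i\<in>{1..N}. AE y in \<nu>. y \<in> laguerre_cell Y N x \<phi>h i \<longrightarrow> S y = x i)"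

definition semidiscrete_plan ::
  "'a::euclidean_space measure \<Rightarrow> ('a \<Rightarrow> 'a) \<Rightarrow> ('a \<times> 'a) measure" where
  "semidiscrete_plan \<nu> S = distr \<nu> (borel \<Otimes>\<^sub>M borel) (\<lambda>y. (S y, y))"

definition error_bound ::
  "real \<Rightarrow> 'a::euclidean_space measure \<Rightarrow> 'a measure \<Rightarrow> 'a measure \<Rightarrow> real" where
  "error_bound lam \<mu> \<nu> \<mu>h =
     2 * sqrt lam * sqrt (W2 \<mu> \<mu>h) * sqrt (W2 \<mu> \<nu> + W2 \<mu> \<mu>h) + lam * W2 \<mu> \<mu>h"

end

theory Submission
  imports Defs
begin

text \<open>Let \<open>W = W2 \<mu> \<mu>h\<close>.  The error is in fact at most \<open>(lam * W)\<^sup>2\<close>, which is sharper than the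
  bound \<open>E_h\<^sup>2\<close> and yields the second estimate with \<open>C = 1\<close>.  Smoothness of \<open>\<phi>\<close> improves
  Fenchel-Young to \<open>\<bar>T z - y\<bar>\<^sup>2 / (2 lam) \<le> \<phi> z + \<phi>* y - z \<bullet> y\<close>.  Integrated along the semi-discrete
  plan, the right-hand side becomes the integral of \<open>\<phi> - \<phi>h\<close> against \<open>\<mu>h\<close> plus that of \<open>\<phi>* - \<phi>h*\<close>
  against \<open>\<nu>\<close>, since \<open>\<phi>h\<close> and its conjugate are optimal potentials for that plan.  Evaluating the
  same two integrals along a coupling of \<open>\<mu>\<close> and \<open>\<mu>h\<close> (with \<open>\<nu>\<close> as image of \<open>\<mu>\<close> under \<open>T\<close>), the
  descent lemma bounds them by \<open>lam / 2\<close> times its transport cost.\<close>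

section \<open>Subgradients, differentiability and the descent lemma\<close>

text \<open>A hyperplane separates the origin from the strict epigraph translated so that the graph
  point over \<open>x\<close> sits at the origin. It cannot be vertical because \<phi> is finite
  everywhere, so its normal, rescaled by the last component, gives \<open>D\<close>.\<close>

lemma convex_subgradient_exists:
  fixes \<phi> :: "'a::euclidean_space \<Rightarrow> real"
  assumes "convex_on UNIV \<phi>"
  obtains D where "\<And>v. \<phi> x + v \<bullet> D \<le> \<phi> (x + v)"
proof -
  define E where "E = {p. \<phi> (x + fst p) - \<phi> x < snd p}"
  have "convex E"
  proof (rule convexI)
    fix p q and u v :: real
    assume pq: "p \<in> E" "q \<in> E" and uv: "0 \<le> u" "0 \<le> v" "u + v = 1"
    have "x = u *\<^sub>R x + v *\<^sub>R x"
      by (metis scaleR_add_left scaleR_one uv(3))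
    then have "x + fst (u *\<^sub>R p + v *\<^sub>R q) = u *\<^sub>R (x + fst p) + v *\<^sub>R (x + fst q)"
      by (simp add: algebra_simps)
    then have "\<phi> (x + fst (u *\<^sub>R p + v *\<^sub>R q)) \<le> u * \<phi> (x + fst p) + v * \<phi> (x + fst q)"
      using assms uv unfolding convex_on_def by simp
    also have "\<dots> < u * (\<phi> x + snd p) + v * (\<phi> x + snd q)"
    \<comment> \<open>Strictness needs a positive weight: \<open>u\<close> if it is nonzero,
      otherwise \<open>v = 1\<close>.\<close>
    proof (cases "u = 0")
      case True
      then show ?thesis using pq uv by (simp add: E_def)
    next
      case False
      then have "u * \<phi> (x + fst p) < u * (\<phi> x + snd p)"
        using pq uv by (simp add: E_def)
      moreover have "v * \<phi> (x + fst q) \<le> v * (\<phi> x + snd q)"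
        using pq uv by (intro mult_left_mono) (auto simp: E_def)
      ultimately show ?thesis by simp
    qed
    also have "\<dots> = (u + v) * \<phi> x + (u * snd p + v * snd q)"
      by (simp add: algebra_simps)
    finally show "u *\<^sub>R p + v *\<^sub>R q \<in> E"
      using uv by (simp add: E_def)
  qed
  moreover have "0 \<notin> E"
    by (simp add: E_def)
  ultimately obtain a where a: "a \<noteq> 0" "\<And>p. p \<in> E \<Longrightarrow> 0 \<le> a \<bullet> p"
    using separating_hyperplane_set_0[of E] by auto
  obtain A b where ab: "a = (A, b)"
    by (cases a)
  have sep: "0 \<le> A \<bullet> v + b * t" if "\<phi> (x + v) - \<phi> x < t" for v t
    using a(2)[of "(v, t)"] that by (simp add: E_def ab)
  \<comment> \<open>If \<open>b = 0\<close>, points over \<open>- A\<close> at any height above the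
    graph force \<open>A = 0\<close>, contradicting that the normal is nonzero.\<close>
  have "0 < b"
  proof (rule ccontr)
    assume "\<not> 0 < b"
    moreover have "0 \<le> b"
      using sep[of 0 1] by simp
    ultimately have "b = 0" by simp
    then have "0 \<le> - (A \<bullet> A)"
      using sep[of "- A" "\<phi> (x - A) - \<phi> x + 1"] by simp
    then have "A \<bullet> A = 0"
      using inner_ge_zero[of A] by linarith
    then show False
      using a(1) \<open>b = 0\<close> by (simp add: ab zero_prod_def)
  qed
  show thesis
  proof (rule that[of "- (1 / b) *\<^sub>R A"])
    fix v
    \<comment> \<open>The set \<open>E\<close> is strict, so the graph itself is reached only with a
      slack \<open>e\<close>, which is then removed.\<close>
    have "\<phi> x + v \<bullet> (- (1 / b) *\<^sub>R A) \<le> \<phi> (x + v) + e" if "0 < e" for e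
      using sep[of v "\<phi> (x + v) - \<phi> x + e"] that \<open>0 < b\<close>
      by (simp add: field_simps inner_commute)
    then show "\<phi> x + v \<bullet> (- (1 / b) *\<^sub>R A) \<le> \<phi> (x + v)"
      by (rule field_le_epsilon)
  qed
qed

text \<open>The second inequality is the descent lemma. Convexity supplies a subgradient
  \<open>D\<close>, smoothness makes the remainder quadratic, and so \<open>D\<close> is the
  derivative; this identifies \<open>D\<close> with the description operator hidden in
  \<open>grad\<close>.\<close>

lemma convex_smooth_grad:
  fixes \<phi> :: "'a::euclidean_space \<Rightarrow> real"
  assumes conv: "convex_on UNIV \<phi>" and sm: "smooth_fun lam \<phi>"
  shows "\<phi> x + v \<bullet> grad \<phi> x \<le> \<phi> (x + v)" (is ?lower)
    and "\<phi> (x + v) \<le> \<phi> x + v \<bullet> grad \<phi> x + lam / 2 * (norm v)\<^sup>2" (is ?upper)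
proof -
  obtain D where D: "\<And>v. \<phi> x + v \<bullet> D \<le> \<phi> (x + v)"
    using convex_subgradient_exists[OF conv, of x] by blast
  text \<open>Smoothness at the midpoint of \<^term>\<open>x + v\<close> and \<^term>\<open>x - v\<close> gives the upper bound with
    a constant that is twice too large, which suffices for differentiability; the sharp constant
    then comes from letting \<open>t\<close> tend to 0 along the segment.\<close>
  have D2: "\<phi> (x + v) \<le> \<phi> x + v \<bullet> D + lam * (norm v)\<^sup>2" for v
  proof -
    have "(x - v) /\<^sub>R 2 + (x + v) /\<^sub>R 2 = x"
      by (simp add: scaleR_right_distrib[symmetric] scaleR_2[symmetric])
    moreover have "(norm (x - v - (x + v)))\<^sup>2 = 4 * (norm v)\<^sup>2"
    proof -
      have "x - v - (x + v) = (-2) *\<^sub>R v"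
        by (simp add: scaleR_2)
      then show ?thesis
        by (simp only: norm_scaleR) (simp add: power_mult_distrib)
    qed
    ultimately have "\<phi> (x - v) / 2 + \<phi> (x + v) / 2 \<le> \<phi> x + lam / 2 * (norm v)\<^sup>2"
      using sm[unfolded smooth_fun_def, rule_format, of "1/2" "x - v" "x + v"]
      by (simp add: inverse_eq_divide)
    then show ?thesis
      using D[of "- v"] by (simp add: algebra_simps)
  qed
  have "(\<phi> has_derivative (\<lambda>h. h \<bullet> D)) (at x)"
  proof (rule has_derivativeI_sandwich[of 1])
    show "bounded_linear (\<lambda>h. h \<bullet> D)"
      by (rule bounded_linear_inner_left)
    show "((\<lambda>y. lam * norm (y - x)) \<longlongrightarrow> 0) (at x)"
      by (auto intro!: tendsto_eq_intros)
    fix y assume "y \<noteq> x"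
    have "\<bar>\<phi> y - \<phi> x - (y - x) \<bullet> D\<bar> \<le> lam * norm (y - x) * norm (y - x)"
      using D[of "y - x"] D2[of "y - x"] by (simp add: power2_eq_square)
    then show "norm (\<phi> y - \<phi> x - (y - x) \<bullet> D) / norm (y - x) \<le> lam * norm (y - x)"
      using \<open>y \<noteq> x\<close> by (simp add: divide_le_eq)
  qed simp
  then have g: "grad \<phi> x = D"
    by (intro grad_eqI) (simp add: gderiv_def)
  show ?lower
    using D g by simp
  \<comment> \<open>Applying \<open>D2\<close> to \<open>t *\<^sub>R v\<close> costs only a term of
    order \<open>t * t\<close>; after division by \<open>t\<close> its constant no longer matters in
    the limit.\<close>
  have "\<phi> (x + v) \<le> \<phi> x + v \<bullet> D + lam / 2 * (norm v)\<^sup>2 + t * (lam / 2 * (norm v)\<^sup>2)"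
    if t: "0 < t" "t < 1" for t
  proof -
    have "(1 - t) *\<^sub>R x + t *\<^sub>R (x + v) = x + t *\<^sub>R v"
      by (simp add: algebra_simps)
    then have "(1 - t) * \<phi> x + t * \<phi> (x + v)
        \<le> \<phi> (x + t *\<^sub>R v) + t * (1 - t) * lam / 2 * (norm v)\<^sup>2"
      using sm[unfolded smooth_fun_def, rule_format, of t x "x + v"] t by simp
    also have "\<dots> \<le> \<phi> x + t * (v \<bullet> D) + lam * (t * norm v)\<^sup>2 + t * (1 - t) * lam / 2 * (norm v)\<^sup>2"
      using D2[of "t *\<^sub>R v"] t by simp
    finally have "t * \<phi> (x + v)
        \<le> t * (\<phi> x + v \<bullet> D + lam / 2 * (norm v)\<^sup>2 + t * (lam / 2 * (norm v)\<^sup>2))"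
      by (simp add: power_mult_distrib power2_eq_square algebra_simps add_divide_distrib diff_divide_distrib)
    then show ?thesis
      using t by (simp only: mult_le_cancel_left_pos)
  qed
  then have "eventually (\<lambda>t. \<phi> (x + v)
      \<le> \<phi> x + v \<bullet> D + lam / 2 * (norm v)\<^sup>2 + t * (lam / 2 * (norm v)\<^sup>2)) (at_right 0)"
    by (auto simp: eventually_at_right_field intro!: exI[of _ 1])
  moreover have "((\<lambda>t. \<phi> x + v \<bullet> D + lam / 2 * (norm v)\<^sup>2 + t * (lam / 2 * (norm v)\<^sup>2))
      \<longlongrightarrow> \<phi> x + v \<bullet> D + lam / 2 * (norm v)\<^sup>2) (at_right 0)"
    by (auto intro!: tendsto_eq_intros)
  ultimately show ?upper
    unfolding g by (intro tendsto_lowerbound[where F = "at_right 0"]) auto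
qed

section \<open>Convex conjugates and Fenchel-Young inequalities\<close>

text \<open>The Legendre-Fenchel transform, with the supremum restricted to \<open>A\<close> so that
  \<open>A = UNIV\<close> serves \<phi> and a finite \<open>A\<close> serves nodal functions. Values
  are extended reals because the supremum over \<open>UNIV\<close> may be infinite.\<close>

definition conjugate :: "'a::euclidean_space set \<Rightarrow> ('a \<Rightarrow> real) \<Rightarrow> 'a \<Rightarrow> ereal" where
  "conjugate A \<phi> y = (SUP p\<in>A. ereal (p \<bullet> y - \<phi> p))"

text \<open>The supremum may be uncountable, but every sublevel set is an intersection of closed
  sets and hence closed.\<close>

lemma borel_measurable_conjugate [measurable]:
  fixes \<phi> :: "'a::euclidean_space \<Rightarrow> real"
  shows "conjugate A \<phi> \<in> borel_measurable borel"
proof (rule borel_measurableI_le)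
  fix c :: ereal
  have "closed {y. ereal (p \<bullet> y - \<phi> p) \<le> c}" for p
    by (intro closed_Collect_le continuous_intros)
  then have "closed (\<Inter>p\<in>A. {y. ereal (p \<bullet> y - \<phi> p) \<le> c})"
    by blast
  also have "(\<Inter>p\<in>A. {y. ereal (p \<bullet> y - \<phi> p) \<le> c}) = {y. conjugate A \<phi> y \<le> c}"
    by (auto simp: conjugate_def SUP_le_iff)
  finally show "{y \<in> space borel. conjugate A \<phi> y \<le> c} \<in> sets borel"
    by simp
qed

text \<open>The equality case of Fenchel-Young: \<open>y\<close> is a subgradient at
  \<open>p\<close> precisely when \<open>p\<close> attains the supremum.\<close>

lemma conjugate_eq:
  assumes "p \<in> A" and "y \<in> discrete_subdiff A \<phi> p"
  shows "conjugate A \<phi> y = ereal (p \<bullet> y - \<phi> p)"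
  unfolding conjugate_def
  using assms by (intro SUP_eqI) (auto simp: discrete_subdiff_def inner_diff_left algebra_simps)

lemma fenchel_young:
  assumes "p \<in> A" and "\<bar>conjugate A \<phi> y\<bar> \<noteq> \<infinity>"
  shows "p \<bullet> y - \<phi> p \<le> real_of_ereal (conjugate A \<phi> y)"
proof -
  have "ereal (p \<bullet> y - \<phi> p) \<le> conjugate A \<phi> y"
    unfolding conjugate_def using assms(1) by (rule SUP_upper)
  then show ?thesis
    using assms(2) by (auto simp: ereal_real[symmetric] simp flip: ereal_less_eq(3))
qed

text \<open>The conjugate is tested at \<open>x + v\<close> instead of \<open>x\<close>, and \<phi>
  there is bounded by the descent lemma. With \<open>d = y - grad \<phi> x\<close> the gain is
  \<open>v \<bullet> d - lam / 2 * (norm v)\<^sup>2\<close>, largest at \<open>v = d / lam\<close>,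
  where it equals \<open>(norm d)\<^sup>2 / (2 * lam)\<close>.\<close>

lemma smooth_fenchel_young:
  fixes \<phi> :: "'a::euclidean_space \<Rightarrow> real"
  assumes "convex_on UNIV \<phi>" and "smooth_fun lam \<phi>" and "lam > 0"
    and fin: "\<bar>conjugate UNIV \<phi> y\<bar> \<noteq> \<infinity>"
  shows "(norm (grad \<phi> x - y))\<^sup>2 / (2 * lam)
    \<le> \<phi> x + real_of_ereal (conjugate UNIV \<phi> y) - x \<bullet> y"
proof -
  define d where "d = y - grad \<phi> x"
  define v where "v = (1 / lam) *\<^sub>R d"
  have "x \<bullet> y + v \<bullet> y - \<phi> (x + v) \<le> real_of_ereal (conjugate UNIV \<phi> y)"
    using fenchel_young[of "x + v" UNIV, OF _ fin] by (simp add: inner_add_left)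
  moreover have "\<phi> (x + v) \<le> \<phi> x + v \<bullet> grad \<phi> x + lam / 2 * (norm v)\<^sup>2"
    by (rule convex_smooth_grad(2)) fact+
  moreover have "v \<bullet> y - v \<bullet> grad \<phi> x = (norm d)\<^sup>2 / lam"
  proof -
    have "v \<bullet> y - v \<bullet> grad \<phi> x = v \<bullet> d"
      by (simp add: d_def inner_diff_right)
    then show ?thesis
      by (simp add: v_def power2_norm_eq_inner)
  qed
  moreover have "lam / 2 * (norm v)\<^sup>2 = (norm d)\<^sup>2 / (2 * lam)"
    using \<open>lam > 0\<close> by (simp add: v_def power_divide power2_eq_square)
  moreover have "(norm d)\<^sup>2 / lam = 2 * ((norm d)\<^sup>2 / (2 * lam))"
    by simp
  ultimately have "(norm d)\<^sup>2 / (2 * lam)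
      \<le> \<phi> x + real_of_ereal (conjugate UNIV \<phi> y) - x \<bullet> y"
    by linarith
  then show ?thesis
    by (simp add: d_def norm_minus_commute)
qed

lemma grad_in_subdiff:
  assumes "convex_on UNIV \<phi>" and "smooth_fun lam \<phi>"
  shows "grad \<phi> x \<in> discrete_subdiff UNIV \<phi> x"
  using convex_smooth_grad(1)[OF assms, of x "q - x" for q]
  by (simp add: discrete_subdiff_def)

section \<open>The error along the semi-discrete plan against the cost of a coupling\<close>

text \<open>\<open>(S y, y)\<close> under \<open>\<nu>\<close> and \<open>(z', T z)\<close> under \<open>\<sigma>\<close>, with \<open>(z, z')\<close> distributed as \<open>\<sigma>\<close>, have the same
  marginals, so a sum \<open>a + b\<close> of functions of one coordinate each has the same integral along
  both.\<close>

lemma semidiscrete_error_coupling: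
  fixes \<mu> \<nu> :: "'a::euclidean_space measure"
  assumes conv: "convex_on UNIV \<phi>" and sm: "smooth_fun lam \<phi>" and "lam > 0"
    and "prob_space \<nu>" and sets_\<mu>: "sets \<mu> = sets borel"
    and T: "grad \<phi> \<in> borel_measurable borel" "distr \<mu> borel (grad \<phi>) = \<nu>"
    and S[measurable]: "S \<in> borel_measurable borel"
    and "finite P"
    and opt: "AE y in \<nu>. S y \<in> P \<and> y \<in> discrete_subdiff P \<phi>h (S y)"
    and \<sigma>: "\<sigma> \<in> couplings \<mu> (distr \<nu> borel S)"
  shows "(\<integral>\<^sup>+ y. ennreal ((norm (grad \<phi> (S y) - y))\<^sup>2) \<partial>\<nu>)
    \<le> ennreal (lam\<^sup>2) * (\<integral>\<^sup>+ p. ennreal ((norm (fst p - snd p))\<^sup>2) \<partial>\<sigma>)"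
proof (cases "(\<integral>\<^sup>+ p. ennreal ((norm (fst p - snd p))\<^sup>2) \<partial>\<sigma>) = \<infinity>")
  case True
  then show ?thesis
    using \<open>lam > 0\<close> by (simp add: ennreal_mult_eq_top_iff)
next
  case False
  interpret \<nu>: prob_space \<nu> by fact
  define T where "T = grad \<phi>"
  have [measurable]: "T \<in> borel_measurable borel"
    using T by (simp add: T_def)
  have sets_\<nu>[measurable_cong]: "sets \<nu> = sets borel"
    unfolding T(2)[symmetric] by simp
  have sets_\<sigma>[measurable_cong]: "sets \<sigma> = sets (borel \<Otimes>\<^sub>M borel)"
    and fst_\<sigma>: "distr \<sigma> borel fst = \<mu>" and snd_\<sigma>: "distr \<sigma> borel snd = distr \<nu> borel S"
    using \<sigma> by (auto simp: couplings_def)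
  \<comment> \<open>Writing \<nu> as an image of \<sigma> lets null sets and integrals pass between
    the two measures.\<close>
  have \<nu>_eq: "\<nu> = distr \<sigma> borel (\<lambda>p. T (fst p))"
  proof -
    have "\<nu> = distr (distr \<sigma> borel fst) borel T"
      using T(2) fst_\<sigma> by (simp add: T_def)
    also have "\<dots> = distr \<sigma> borel (\<lambda>p. T (fst p))"
      by (subst distr_distr) (auto simp: comp_def)
    finally show ?thesis .
  qed

  \<comment> \<open>Equal to \<open>\<phi> - \<phi>h\<close> on the nodes and 0 elsewhere. As a
    finite combination of indicators it is measurable and bounded by \<open>M\<close>, although
    \<open>\<phi>h\<close> is an arbitrary function off \<open>P\<close>.\<close>
  define a where "a = (\<lambda>z. \<Sum>p\<in>P. (\<phi> p - \<phi>h p) * indicat_real {p} z)"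
  \<comment> \<open>Infinite conjugates become 0 here; \<open>fin\<close> and \<open>finP\<close>
    show that they occur only on a null set.\<close>
  define b where "b = (\<lambda>y. real_of_ereal (conjugate UNIV \<phi> y) - real_of_ereal (conjugate P \<phi>h y))"
  define M where "M = (\<Sum>p\<in>P. \<bar>\<phi> p - \<phi>h p\<bar>)"
  have [measurable]: "a \<in> borel_measurable borel" "b \<in> borel_measurable borel"
    unfolding a_def b_def by measurable
  have a_eq: "a z = \<phi> z - \<phi>h z" if "z \<in> P" for z
    using that \<open>finite P\<close> by (simp add: a_def indicator_def sum.delta if_distrib cong: if_cong)
  have a_bound: "\<bar>a z\<bar> \<le> M" for z
    unfolding a_def M_def
    by (rule order_trans[OF sum_abs]) (auto intro!: sum_mono simp: indicator_def)

  have conj_T: "conjugate UNIV \<phi> (T x) = ereal (x \<bullet> T x - \<phi> x)" for x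
    unfolding T_def by (intro conjugate_eq grad_in_subdiff[OF conv sm]) simp
  have fin: "AE y in \<nu>. \<bar>conjugate UNIV \<phi> y\<bar> \<noteq> \<infinity>"
    unfolding \<nu>_eq by (subst AE_distr_iff) (auto simp: conj_T)
  \<comment> \<open>Along the plan Fenchel-Young is an equality for \<open>\<phi>h\<close>, so the
    \<open>\<phi>h\<close> terms cancel and \<open>a (S y) + b y\<close> is the Fenchel-Young gap of
    \<phi>.\<close>
  have lower: "AE y in \<nu>. (norm (T (S y) - y))\<^sup>2 / (2 * lam) \<le> a (S y) + b y"
    using opt fin
  proof eventually_elim
    case (elim y)
    then have "conjugate P \<phi>h y = ereal (S y \<bullet> y - \<phi>h (S y))"
      by (intro conjugate_eq) auto
    with smooth_fenchel_young[OF conv sm \<open>lam > 0\<close> elim(2), of "S y"] elim show ?case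
      by (simp add: a_eq b_def T_def)
  qed
  have finP: "AE y in \<nu>. \<bar>conjugate P \<phi>h y\<bar> \<noteq> \<infinity>"
    using opt by eventually_elim (auto simp: conjugate_eq)
  have finP': "AE p in \<sigma>. \<bar>conjugate P \<phi>h (T (fst p))\<bar> \<noteq> \<infinity>"
    using finP unfolding \<nu>_eq by (subst (asm) AE_distr_iff) auto
  have "AE y in \<nu>. S y \<in> P"
    using opt by eventually_elim simp
  then have "AE z in distr \<sigma> borel snd. z \<in> P"
    unfolding snd_\<sigma> using \<open>finite P\<close>
    by (subst AE_distr_iff) (auto intro: borel_closed finite_imp_closed)
  then have sndP: "AE p in \<sigma>. snd p \<in> P"
    by (rule AE_distrD[rotated]) simp
  \<comment> \<open>Along \<sigma> the roles are exchanged: equality for \<phi> at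
    \<open>fst p\<close>, inequality for \<open>\<phi>h\<close> at \<open>snd p\<close>. What
    remains is the gap in the descent lemma between these two points.\<close>
  have upper: "AE p in \<sigma>. a (snd p) + b (T (fst p)) \<le> lam / 2 * (norm (fst p - snd p))\<^sup>2"
    using finP' sndP
  proof eventually_elim
    case (elim p)
    have "snd p \<bullet> T (fst p) - \<phi>h (snd p) \<le> real_of_ereal (conjugate P \<phi>h (T (fst p)))"
      using elim by (intro fenchel_young)
    moreover have "\<phi> (snd p) \<le> \<phi> (fst p) + (snd p - fst p) \<bullet> T (fst p)
        + lam / 2 * (norm (snd p - fst p))\<^sup>2"
      using convex_smooth_grad(2)[OF conv sm, of "fst p" "snd p - fst p"] by (simp add: T_def)
    ultimately show ?case
      using elim by (simp add: a_eq b_def conj_T inner_diff_left norm_minus_commute)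
  qed

  have b_lower: "AE y in \<nu>. - M \<le> b y"
    using lower
  proof eventually_elim
    case (elim y)
    have "0 \<le> (norm (T (S y) - y))\<^sup>2 / (2 * lam)"
      using \<open>lam > 0\<close> by simp
    then show ?case
      using elim a_bound[of "S y"] by linarith
  qed
  have b_lower': "AE p in \<sigma>. - M \<le> b (T (fst p))"
    using b_lower unfolding \<nu>_eq by (subst (asm) AE_distr_iff) auto
  \<comment> \<open>Its image \<nu> has mass one.\<close>
  have "prob_space \<sigma>"
    using \<open>prob_space \<nu>\<close> unfolding \<nu>_eq by (rule prob_space_distrD[rotated]) measurable
  then interpret \<sigma>: prob_space \<sigma> .
  have int_cost: "integrable \<sigma> (\<lambda>p. (norm (fst p - snd p))\<^sup>2)"
    using False by (intro integrableI_bounded) (auto simp: less_top)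
  \<comment> \<open>Since \<open>a\<close> is bounded, \<open>lower\<close> bounds \<open>b\<close>
    from below by a constant and \<open>upper\<close> bounds it from above by a constant plus the
    integrable cost. Both hold on \<sigma>, from where integrability passes to \<nu>.\<close>
  have int_b': "integrable \<sigma> (\<lambda>p. b (T (fst p)))"
  proof (rule Bochner_Integration.integrable_bound)
    show "integrable \<sigma> (\<lambda>p. M + lam / 2 * (norm (fst p - snd p))\<^sup>2)"
      using int_cost by auto
    show "AE p in \<sigma>. norm (b (T (fst p))) \<le> norm (M + lam / 2 * (norm (fst p - snd p))\<^sup>2)"
      using upper b_lower'
    proof eventually_elim
      case (elim p)
      have "0 \<le> lam / 2 * (norm (fst p - snd p))\<^sup>2"
        using \<open>lam > 0\<close> by simp
      then show ?case
        using elim a_bound[of "snd p"] by simp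
    qed
  qed measurable
  have int_b: "integrable \<nu> b"
    using int_b' unfolding \<nu>_eq by (subst integrable_distr_eq) auto
  have int_a: "integrable \<nu> (\<lambda>y. a (S y))"
    by (rule \<nu>.integrable_const_bound[of _ M]) (auto simp: a_bound)
  have int_a': "integrable \<sigma> (\<lambda>p. a (snd p))"
    by (rule \<sigma>.integrable_const_bound[of _ M]) (auto simp: a_bound)
  have "(\<integral>y. a (S y) \<partial>\<nu>) = (\<integral>z. a z \<partial>distr \<nu> borel S)"
    by (subst integral_distr) auto
  also have "\<dots> = (\<integral>p. a (snd p) \<partial>\<sigma>)"
    by (subst snd_\<sigma>[symmetric], subst integral_distr) auto
  finally have eq_a: "(\<integral>y. a (S y) \<partial>\<nu>) = (\<integral>p. a (snd p) \<partial>\<sigma>)" .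
  have eq_b: "(\<integral>y. b y \<partial>\<nu>) = (\<integral>p. b (T (fst p)) \<partial>\<sigma>)"
    unfolding \<nu>_eq by (subst integral_distr) auto
  have "(\<integral>y. a (S y) + b y \<partial>\<nu>) = (\<integral>p. a (snd p) + b (T (fst p)) \<partial>\<sigma>)"
    using int_a int_a' int_b int_b' eq_a eq_b by simp
  also have "\<dots> \<le> (\<integral>p. lam / 2 * (norm (fst p - snd p))\<^sup>2 \<partial>\<sigma>)"
    using int_a' int_b' int_cost upper by (intro integral_mono_AE) auto
  finally have key: "(\<integral>y. a (S y) + b y \<partial>\<nu>) \<le> lam / 2 * (\<integral>p. (norm (fst p - snd p))\<^sup>2 \<partial>\<sigma>)"
    by simp

  have "(\<integral>\<^sup>+ y. ennreal ((norm (T (S y) - y))\<^sup>2) \<partial>\<nu>)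
      \<le> (\<integral>\<^sup>+ y. ennreal (2 * lam * (a (S y) + b y)) \<partial>\<nu>)"
    using lower \<open>lam > 0\<close>
    by (intro nn_integral_mono_AE) (auto simp: field_simps intro!: ennreal_leI elim!: eventually_mono)
  also have "\<dots> = ennreal (\<integral>y. 2 * lam * (a (S y) + b y) \<partial>\<nu>)"
  proof (rule nn_integral_eq_integral)
    show "integrable \<nu> (\<lambda>y. 2 * lam * (a (S y) + b y))"
      using int_a int_b by auto
    show "AE y in \<nu>. 0 \<le> 2 * lam * (a (S y) + b y)"
      using lower
    proof eventually_elim
      case (elim y)
      have "0 \<le> (norm (T (S y) - y))\<^sup>2 / (2 * lam)"
        using \<open>lam > 0\<close> by simp
      then have "0 \<le> a (S y) + b y"
        using elim by linarith
      then show ?case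
        using \<open>lam > 0\<close> by simp
    qed
  qed
  \<comment> \<open>The factor \<open>2 * lam\<close> from \<open>lower\<close> meets
    \<open>lam / 2\<close> from \<open>key\<close>.\<close>
  also have "\<dots> \<le> ennreal (lam\<^sup>2 * (\<integral>p. (norm (fst p - snd p))\<^sup>2 \<partial>\<sigma>))"
    using mult_left_mono[OF key, of "2 * lam"] \<open>lam > 0\<close>
    by (intro ennreal_leI) (simp add: power2_eq_square)
  also have "\<dots> = ennreal (lam\<^sup>2) * ennreal (\<integral>p. (norm (fst p - snd p))\<^sup>2 \<partial>\<sigma>)"
    by (simp add: ennreal_mult')
  also have "ennreal (\<integral>p. (norm (fst p - snd p))\<^sup>2 \<partial>\<sigma>)
      = (\<integral>\<^sup>+ p. ennreal ((norm (fst p - snd p))\<^sup>2) \<partial>\<sigma>)"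
    using int_cost by (intro nn_integral_eq_integral[symmetric]) auto
  finally show ?thesis
    by (simp add: T_def)
qed

section \<open>The Wasserstein distance on \<open>P2\<close>\<close>

text \<open>The product measure is a coupling of finite cost, because the squared distance is at
  most twice the sum of the squared norms. The infimum is therefore finite and survives
  \<open>enn2real\<close>.\<close>

lemma W2_power2:
  fixes \<mu> \<nu> :: "'a::euclidean_space measure"
  assumes "\<mu> \<in> P2" and "\<nu> \<in> P2"
  shows "ennreal ((W2 \<mu> \<nu>)\<^sup>2)
    = (INF \<gamma>\<in>couplings \<mu> \<nu>. \<integral>\<^sup>+ p. ennreal ((norm (fst p - snd p))\<^sup>2) \<partial>\<gamma>)" (is "_ = ?I")
proof -
  interpret \<mu>: prob_space \<mu> using assms by (simp add: P2_def)
  interpret \<nu>: prob_space \<nu> using assms by (simp add: P2_def)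
  interpret \<mu>\<nu>: pair_prob_space \<mu> \<nu> ..
  have sets[measurable_cong]: "sets \<mu> = sets borel" "sets \<nu> = sets borel"
    using assms by (auto simp: P2_def)
  have fin: "(\<integral>\<^sup>+ x. ennreal ((norm x)\<^sup>2) \<partial>\<mu>) < \<infinity>" "(\<integral>\<^sup>+ x. ennreal ((norm x)\<^sup>2) \<partial>\<nu>) < \<infinity>"
    using assms by (auto simp: P2_def)
  have fst: "distr (\<mu> \<Otimes>\<^sub>M \<nu>) borel fst = \<mu>"
    using \<nu>.distr_pair_fst[of \<mu>] by (simp add: sets cong: distr_cong)
  have snd: "distr (\<mu> \<Otimes>\<^sub>M \<nu>) borel snd = \<nu>"
  proof -
    have "distr (\<mu> \<Otimes>\<^sub>M \<nu>) borel snd = distr (distr (\<nu> \<Otimes>\<^sub>M \<mu>) (\<mu> \<Otimes>\<^sub>M \<nu>) (\<lambda>(x, y). (y, x))) borel snd"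
      by (subst \<mu>\<nu>.distr_pair_swap) simp
    also have "\<dots> = distr (\<nu> \<Otimes>\<^sub>M \<mu>) borel fst"
      by (subst distr_distr) (auto simp: comp_def case_prod_beta)
    also have "\<dots> = \<nu>"
      using \<mu>.distr_pair_fst[of \<nu>] by (simp add: sets cong: distr_cong)
    finally show ?thesis .
  qed
  have "(\<integral>\<^sup>+ p. ennreal ((norm (fst p - snd p))\<^sup>2) \<partial>(\<mu> \<Otimes>\<^sub>M \<nu>))
      \<le> (\<integral>\<^sup>+ p. 2 * ennreal ((norm (fst p))\<^sup>2) + 2 * ennreal ((norm (snd p))\<^sup>2) \<partial>(\<mu> \<Otimes>\<^sub>M \<nu>))"
  proof (rule nn_integral_mono)
    fix p :: "'a \<times> 'a"
    have "(norm (fst p - snd p))\<^sup>2 \<le> (norm (fst p) + norm (snd p))\<^sup>2"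
      by (intro power_mono norm_triangle_ineq4) simp
    also have "\<dots> \<le> 2 * (norm (fst p))\<^sup>2 + 2 * (norm (snd p))\<^sup>2"
      using sum_squares_bound[of "norm (fst p)" "norm (snd p)"] by (simp add: power2_sum)
    finally have "ennreal ((norm (fst p - snd p))\<^sup>2)
        \<le> ennreal (2 * (norm (fst p))\<^sup>2 + 2 * (norm (snd p))\<^sup>2)"
      by (rule ennreal_leI)
    then show "ennreal ((norm (fst p - snd p))\<^sup>2)
        \<le> 2 * ennreal ((norm (fst p))\<^sup>2) + 2 * ennreal ((norm (snd p))\<^sup>2)"
      by (simp add: ennreal_plus ennreal_mult)
  qed
  also have "\<dots> = 2 * (\<integral>\<^sup>+ p. ennreal ((norm (fst p))\<^sup>2) \<partial>(\<mu> \<Otimes>\<^sub>M \<nu>))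
      + 2 * (\<integral>\<^sup>+ p. ennreal ((norm (snd p))\<^sup>2) \<partial>(\<mu> \<Otimes>\<^sub>M \<nu>))"
    by (simp add: nn_integral_add nn_integral_cmult)
  also have "(\<integral>\<^sup>+ p. ennreal ((norm (fst p))\<^sup>2) \<partial>(\<mu> \<Otimes>\<^sub>M \<nu>)) = (\<integral>\<^sup>+ x. ennreal ((norm x)\<^sup>2) \<partial>\<mu>)"
    by (subst (2) fst[symmetric], subst nn_integral_distr) auto
  also have "(\<integral>\<^sup>+ p. ennreal ((norm (snd p))\<^sup>2) \<partial>(\<mu> \<Otimes>\<^sub>M \<nu>)) = (\<integral>\<^sup>+ x. ennreal ((norm x)\<^sup>2) \<partial>\<nu>)"
    by (subst (2) snd[symmetric], subst nn_integral_distr) auto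
  also have "2 * (\<integral>\<^sup>+ x. ennreal ((norm x)\<^sup>2) \<partial>\<mu>) + 2 * (\<integral>\<^sup>+ x. ennreal ((norm x)\<^sup>2) \<partial>\<nu>) < \<infinity>"
    using fin by (auto simp: ennreal_mult_less_top)
  finally have "(\<integral>\<^sup>+ p. ennreal ((norm (fst p - snd p))\<^sup>2) \<partial>(\<mu> \<Otimes>\<^sub>M \<nu>)) < \<infinity>" .
  moreover have "\<mu> \<Otimes>\<^sub>M \<nu> \<in> couplings \<mu> \<nu>"
    using fst snd by (auto simp: couplings_def sets intro!: sets_pair_measure_cong)
  ultimately have "?I < \<infinity>"
    by (auto simp: INF_less_iff)
  then show ?thesis
    by (simp add: W2_def)
qed

lemma W2_nonneg: "0 \<le> W2 \<mu> \<nu>"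
  by (simp add: W2_def)

lemma discrete_measure_in_P2:
  assumes "prob_space (discrete_measure N w x)"
  shows "discrete_measure N w x \<in> P2"
proof -
  have "(\<integral>\<^sup>+ z. ennreal ((norm z)\<^sup>2) \<partial>discrete_measure N w x)
      = (\<Sum>i=1..N. ennreal (w i) * ennreal ((norm (x i))\<^sup>2))"
    unfolding discrete_measure_def
    by (subst nn_integral_distr) (auto simp: nn_integral_point_measure_finite)
  also have "\<dots> < \<infinity>"
    by (auto simp: ennreal_mult_less_top)
  finally show ?thesis
    using assms by (auto simp: P2_def discrete_measure_def)
qed

section \<open>Laguerre cells and the semi-discrete plan\<close>

lemma closed_discrete_subdiff: "closed (discrete_subdiff P \<phi> p)"
proof -
  have "closed {y. \<phi> p + (q - p) \<bullet> y \<le> \<phi> q}" for q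
    by (intro closed_Collect_le continuous_intros)
  then have "closed (\<Inter>q\<in>P. {y. \<phi> p + (q - p) \<bullet> y \<le> \<phi> q})"
    by blast
  also have "(\<Inter>q\<in>P. {y. \<phi> p + (q - p) \<bullet> y \<le> \<phi> q}) = discrete_subdiff P \<phi> p"
    by (auto simp: discrete_subdiff_def)
  finally show ?thesis .
qed

text \<open>The nodes whose subdifferential contains \<open>y\<close> are the minimisers of
  \<open>\<phi> p - p \<bullet> y\<close>, and a finite nonempty set has one.\<close>

lemma discrete_subdiff_covers:
  assumes "finite P" and "P \<noteq> {}"
  shows "\<exists>p\<in>P. y \<in> discrete_subdiff P \<phi> p"
proof -
  obtain p where "p \<in> P" and "\<And>q. q \<in> P \<Longrightarrow> \<phi> p - p \<bullet> y \<le> \<phi> q - q \<bullet> y"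
    using ex_min_if_finite[of "(\<lambda>p. \<phi> p - p \<bullet> y) ` P"] assms
    by (metis (no_types, lifting) finite_imageI image_iff image_is_empty not_le_imp_less)
  then show ?thesis
    by (force simp: discrete_subdiff_def inner_diff_left)
qed

text \<open>The cells cover \<open>Y\<close>. Almost nowhere do two of them overlap, since
  \<open>S y\<close> would have to equal two distinct nodes; the existence of \<open>S\<close> thus
  already makes the overlaps null.\<close>

lemma semidiscrete_map_AE:
  assumes S: "semidiscrete_map \<nu> Y N x \<phi>h S" and inj: "inj_on x {1..N}" and "1 \<le> N"
    and Y: "AE y in \<nu>. y \<in> Y"
  shows "AE y in \<nu>. \<exists>i\<in>{1..N}. S y = x i \<and>
    (\<forall>j\<in>{1..N}. y \<in> laguerre_cell Y N x \<phi>h j \<longleftrightarrow> j = i)"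
proof -
  have "AE y in \<nu>. \<forall>i\<in>{1..N}. y \<in> laguerre_cell Y N x \<phi>h i \<longrightarrow> S y = x i"
    using S by (intro AE_finite_allI) (auto simp: semidiscrete_map_def)
  then show ?thesis
    using Y
  proof eventually_elim
    case (elim y)
    obtain i where i: "i \<in> {1..N}" "y \<in> laguerre_cell Y N x \<phi>h i"
      using discrete_subdiff_covers[of "x ` {1..N}" y \<phi>h] \<open>1 \<le> N\<close> elim(2)
      by (auto simp: laguerre_cell_def)
    have "j = i" if "j \<in> {1..N}" "y \<in> laguerre_cell Y N x \<phi>h j" for j
      using elim(1) i that inj by (metis inj_onD)
    with i elim(1) show ?case
      by blast
  qed
qed

text \<open>Almost everywhere exactly one summand survives. The sum stays under the integral so that
  \<open>k\<close> may be arbitrary; with an indicator for \<open>k\<close> this yields the first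
  marginal of the plan, with the squared error it yields the sum over cells.\<close>

lemma nn_integral_semidiscrete_map:
  fixes k :: "'a::euclidean_space \<Rightarrow> 'a \<Rightarrow> ennreal"
  assumes "semidiscrete_map \<nu> Y N x \<phi>h S" and "inj_on x {1..N}" and "1 \<le> N"
    and "AE y in \<nu>. y \<in> Y"
  shows "(\<integral>\<^sup>+ y. k (S y) y \<partial>\<nu>)
    = (\<integral>\<^sup>+ y. (\<Sum>i=1..N. k (x i) y * indicator (laguerre_cell Y N x \<phi>h i) y) \<partial>\<nu>)"
proof (rule nn_integral_cong_AE)
  show "AE y in \<nu>. k (S y) y = (\<Sum>i=1..N. k (x i) y * indicator (laguerre_cell Y N x \<phi>h i) y)"
    using semidiscrete_map_AE[OF assms]
  proof eventually_elim
    case (elim y)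
    then obtain i where i: "i \<in> {1..N}" "S y = x i"
      and *: "\<And>j. j \<in> {1..N} \<Longrightarrow> y \<in> laguerre_cell Y N x \<phi>h j \<longleftrightarrow> j = i"
      by blast
    have "(\<Sum>j=1..N. k (x j) y * indicator (laguerre_cell Y N x \<phi>h j) y)
        = (\<Sum>j=1..N. if j = i then k (x i) y else 0)"
      by (rule sum.cong[OF refl]) (simp add: indicator_def *)
    also have "\<dots> = k (S y) y"
      using i by (simp del: atLeastAtMost_iff)
    finally show ?case ..
  qed
qed

text \<open>The prescribed cell masses are exactly the weights of the nodes, so the first marginal
  of the plan is the discrete measure and couplings of \<mu> with it can be compared with the
  plan.\<close>

lemma semidiscrete_distr:
  fixes \<nu> :: "'a::euclidean_space measure"
  assumes sets_\<nu>: "sets \<nu> = sets borel"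
    and S: "semidiscrete_map \<nu> Y N x \<phi>h S" and inj: "inj_on x {1..N}" and "1 \<le> N"
    and Y: "AE y in \<nu>. y \<in> Y" "Y \<in> sets borel"
    and w: "\<forall>i\<in>{1..N}. emeasure \<nu> (laguerre_cell Y N x \<phi>h i) = ennreal (w i)"
  shows "distr \<nu> borel S = discrete_measure N w x"
proof (rule measure_eqI)
  show "sets (distr \<nu> borel S) = sets (discrete_measure N w x)"
    by (simp add: discrete_measure_def)
  fix A assume "A \<in> sets (distr \<nu> borel S)"
  then have A[measurable]: "A \<in> sets borel" by simp
  have [measurable]: "S \<in> borel_measurable \<nu>"
    using S sets_\<nu> by (simp add: semidiscrete_map_def cong: measurable_cong_sets)
  have F: "laguerre_cell Y N x \<phi>h i \<in> sets \<nu>" for i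
    unfolding laguerre_cell_def sets_\<nu>
    by (intro sets.Int borel_closed closed_discrete_subdiff Y(2))
  have "emeasure (distr \<nu> borel S) A = (\<integral>\<^sup>+ z. indicator A z \<partial>distr \<nu> borel S)"
    by simp
  also have "\<dots> = (\<integral>\<^sup>+ y. indicator A (S y) \<partial>\<nu>)"
    by (intro nn_integral_distr) auto
  also have "\<dots> = (\<integral>\<^sup>+ y. (\<Sum>i=1..N. indicator A (x i) * indicator (laguerre_cell Y N x \<phi>h i) y) \<partial>\<nu>)"
    by (rule nn_integral_semidiscrete_map[OF S inj \<open>1 \<le> N\<close> Y(1)])
  also have "\<dots> = (\<Sum>i=1..N. indicator A (x i) * emeasure \<nu> (laguerre_cell Y N x \<phi>h i))"
    using F by (subst nn_integral_sum) (simp_all only: nn_integral_cmult_indicator 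
      borel_measurable_times_ennreal borel_measurable_const borel_measurable_indicator)
  also have "\<dots> = emeasure (discrete_measure N w x) A"
    unfolding emeasure_discrete_measure[OF A]
    by (intro sum.cong refl) (simp only: w[rule_format] mult.commute)
  finally show "emeasure (distr \<nu> borel S) A = emeasure (discrete_measure N w x) A" .
qed

text \<open>The first form is the one to be stated, the second the one to be estimated. Restricting
  to \<open>X \<times> Y\<close> loses nothing, because almost surely \<open>S y\<close> is a node,
  hence in \<open>X\<close>, and \<open>y\<close> lies in \<open>Y\<close>.\<close>

lemma semidiscrete_plan_integral:
  fixes \<nu> :: "'a::euclidean_space measure"
  assumes g: "has_lebesgue_density \<nu> g" and Y: "Y = {y. g y > 0}"
    and S: "semidiscrete_map \<nu> Y N x \<phi>h S" and inj: "inj_on x {1..N}" and "1 \<le> N"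
    and X: "X \<in> sets borel" "\<forall>i\<in>{1..N}. x i \<in> X"
    and T[measurable]: "T \<in> borel_measurable borel"
  shows "(\<integral>\<^sup>+ p \<in> X \<times> Y. ennreal ((norm (T (fst p) - snd p))\<^sup>2) \<partial>semidiscrete_plan \<nu> S)
      = (\<Sum>i=1..N. \<integral>\<^sup>+ y \<in> laguerre_cell Y N x \<phi>h i.
            ennreal ((norm (T (x i) - y))\<^sup>2 * g y) \<partial>lborel)" (is "?I = ?R")
    and "(\<integral>\<^sup>+ p \<in> X \<times> Y. ennreal ((norm (T (fst p) - snd p))\<^sup>2) \<partial>semidiscrete_plan \<nu> S)
      = (\<integral>\<^sup>+ y. ennreal ((norm (T (S y) - y))\<^sup>2) \<partial>\<nu>)" (is "_ = ?J")
proof -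
  have [measurable]: "g \<in> borel_measurable borel" and g0: "\<And>y. 0 \<le> g y"
    and \<nu>: "\<nu> = density lborel (\<lambda>y. ennreal (g y))"
    using g by (auto simp: has_lebesgue_density_def)
  have sets_\<nu>[measurable_cong]: "sets \<nu> = sets borel"
    by (simp add: \<nu>)
  have [measurable]: "S \<in> borel_measurable borel"
    using S by (simp add: semidiscrete_map_def)
  have Y_sets[measurable]: "Y \<in> sets borel"
    unfolding Y by measurable
  note X(1)[measurable]
  have F[measurable]: "laguerre_cell Y N x \<phi>h i \<in> sets borel" for i
    unfolding laguerre_cell_def by (intro sets.Int borel_closed closed_discrete_subdiff Y_sets)
  have AE_Y: "AE y in \<nu>. y \<in> Y"
    unfolding \<nu> by (subst AE_density) (auto simp: Y)
  note AE_S = semidiscrete_map_AE[OF S inj \<open>1 \<le> N\<close> AE_Y]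
  have "?I = (\<integral>\<^sup>+ y. ennreal ((norm (T (S y) - y))\<^sup>2) * indicator (X \<times> Y) (S y, y) \<partial>\<nu>)"
    unfolding semidiscrete_plan_def by (subst nn_integral_distr) auto
  also have "\<dots> = ?J"
  proof (rule nn_integral_cong_AE)
    show "AE y in \<nu>. ennreal ((norm (T (S y) - y))\<^sup>2) * indicator (X \<times> Y) (S y, y)
        = ennreal ((norm (T (S y) - y))\<^sup>2)"
      using AE_S AE_Y by eventually_elim (use X(2) in auto)
  qed
  finally show IJ: "?I = ?J" .
  have "?J = (\<integral>\<^sup>+ y. (\<Sum>i=1..N. ennreal ((norm (T (x i) - y))\<^sup>2)
      * indicator (laguerre_cell Y N x \<phi>h i) y) \<partial>\<nu>)"
    by (rule nn_integral_semidiscrete_map[OF S inj \<open>1 \<le> N\<close> AE_Y])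
  also have "\<dots> = (\<Sum>i=1..N. \<integral>\<^sup>+ y. ennreal ((norm (T (x i) - y))\<^sup>2)
      * indicator (laguerre_cell Y N x \<phi>h i) y \<partial>\<nu>)"
    by (rule nn_integral_sum) measurable
  also have "\<dots> = ?R"
    unfolding \<nu> using g0
    by (intro sum.cong refl, subst nn_integral_density)
       (auto simp: ennreal_mult ac_simps intro!: nn_integral_cong)
  finally show "?I = ?R"
    using IJ by simp
qed

section \<open>The error estimates in terms of the Wasserstein distance\<close>

text \<open>The bound by the cost of a coupling holds for every coupling, so the infimum may be
  taken; attainment is not involved.\<close>

lemma semidiscrete_error_W2:
  fixes \<mu> \<nu> :: "'a::euclidean_space measure"
  assumes P2: "\<mu> \<in> P2" "\<nu> \<in> P2" and reg: "regular lam \<mu> \<nu> \<phi>" and "lam > 0"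
    and S: "semidiscrete_map \<nu> Y N x \<phi>h S" and inj: "inj_on x {1..N}" and "1 \<le> N"
    and Y: "AE y in \<nu>. y \<in> Y" "Y \<in> sets borel"
    and w: "\<forall>i\<in>{1..N}. emeasure \<nu> (laguerre_cell Y N x \<phi>h i) = ennreal (w i)"
  shows "(\<integral>\<^sup>+ y. ennreal ((norm (grad \<phi> (S y) - y))\<^sup>2) \<partial>\<nu>)
    \<le> ennreal ((lam * W2 \<mu> (discrete_measure N w x))\<^sup>2)"
proof -
  have \<mu>: "sets \<mu> = sets borel" and \<nu>: "prob_space \<nu>" "sets \<nu> = sets borel"
    using P2 by (auto simp: P2_def)
  have reg': "convex_on UNIV \<phi>" "smooth_fun lam \<phi>"
      "grad \<phi> \<in> borel_measurable borel" "distr \<mu> borel (grad \<phi>) = \<nu>"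
    using reg by (auto simp: regular_def optimal_transport_map_def transport_maps_def)
  have S': "S \<in> borel_measurable borel"
    using S by (simp add: semidiscrete_map_def)
  have distr: "distr \<nu> borel S = discrete_measure N w x"
    by (rule semidiscrete_distr[OF \<nu>(2) S inj \<open>1 \<le> N\<close> Y w])
  have "prob_space (distr \<nu> borel S)"
    using S' \<nu> by (intro prob_space.prob_space_distr) (auto cong: measurable_cong_sets)
  then have P2h: "discrete_measure N w x \<in> P2"
    unfolding distr by (rule discrete_measure_in_P2)
  have opt: "AE y in \<nu>. S y \<in> x ` {1..N} \<and> y \<in> discrete_subdiff (x ` {1..N}) \<phi>h (S y)"
    using semidiscrete_map_AE[OF S inj \<open>1 \<le> N\<close> Y(1)]
    by eventually_elim (auto simp: laguerre_cell_def)
  let ?cost = "\<lambda>\<sigma>. \<integral>\<^sup>+ p. ennreal ((norm (fst p - snd p))\<^sup>2) \<partial>\<sigma>"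
  let ?E = "\<integral>\<^sup>+ y. ennreal ((norm (grad \<phi> (S y) - y))\<^sup>2) \<partial>\<nu>"
  \<comment> \<open>The factor \<open>lam\<^sup>2\<close> is moved to the left side so that the
    infimum stands alone, and is moved back afterwards.\<close>
  have lam2: "ennreal (1 / lam\<^sup>2) * ennreal (lam\<^sup>2) = 1"
    using \<open>lam > 0\<close> by (simp flip: ennreal_mult')
  have "ennreal (1 / lam\<^sup>2) * ?E \<le> (INF \<sigma>\<in>couplings \<mu> (discrete_measure N w x). ?cost \<sigma>)"
  proof (rule INF_greatest)
    fix \<sigma> assume "\<sigma> \<in> couplings \<mu> (discrete_measure N w x)"
    then have "?E \<le> ennreal (lam\<^sup>2) * ?cost \<sigma>"
      using semidiscrete_error_coupling[OF reg'(1,2) \<open>lam > 0\<close> \<nu>(1) \<mu> reg'(3,4) S' _ opt]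
      by (simp add: distr)
    then have "ennreal (1 / lam\<^sup>2) * ?E \<le> ennreal (1 / lam\<^sup>2) * (ennreal (lam\<^sup>2) * ?cost \<sigma>)"
      by (rule mult_left_mono) simp
    then show "ennreal (1 / lam\<^sup>2) * ?E \<le> ?cost \<sigma>"
      by (simp only: mult.assoc[symmetric] lam2 mult_1_left)
  qed
  then have "ennreal (lam\<^sup>2) * (ennreal (1 / lam\<^sup>2) * ?E)
      \<le> ennreal (lam\<^sup>2) * (INF \<sigma>\<in>couplings \<mu> (discrete_measure N w x). ?cost \<sigma>)"
    by (rule mult_left_mono) simp
  then have "?E \<le> ennreal (lam\<^sup>2) * (INF \<sigma>\<in>couplings \<mu> (discrete_measure N w x). ?cost \<sigma>)"
    by (simp only: mult.assoc[symmetric] mult.commute[of "ennreal (lam\<^sup>2)"] lam2 mult_1_left)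
  also have "\<dots> = ennreal ((lam * W2 \<mu> (discrete_measure N w x))\<^sup>2)"
    by (simp add: W2_power2[OF P2(1) P2h, symmetric] ennreal_mult power_mult_distrib)
  finally show ?thesis .
qed

theorem theorem4p1:
  fixes \<mu> \<nu> :: "'a::euclidean_space measure"
  assumes "\<mu> \<in> P2" and "\<nu> \<in> P2"
  shows "\<exists>C::real. \<forall>(f::'a \<Rightarrow> real) (g::'a \<Rightarrow> real) (lam::real) (\<phi>::'a \<Rightarrow> real)
      (X::'a set) (Y::'a set) (N::nat) (x::nat \<Rightarrow> 'a) (w::nat \<Rightarrow> real) (\<mu>h::'a measure)
      (\<phi>h::'a \<Rightarrow> real) (F::nat \<Rightarrow> 'a set) (S::'a \<Rightarrow> 'a) (\<gamma>h::('a \<times> 'a) measure) (T::'a \<Rightarrow> 'a).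
    has_lebesgue_density \<mu> f \<longrightarrow>
    has_lebesgue_density \<nu> g \<longrightarrow>
    lam > 0 \<longrightarrow>
    regular lam \<mu> \<nu> \<phi> \<longrightarrow>
    T = grad \<phi> \<longrightarrow>
    Y = {y. g y > 0} \<longrightarrow>
    X \<in> sets borel \<longrightarrow>
    (AE z in \<mu>. z \<in> X) \<longrightarrow>
    inj_on x {1..N} \<longrightarrow>
    (\<forall>i\<in>{1..N}. x i \<in> X) \<longrightarrow>
    (\<forall>i\<in>{1..N}. w i > 0) \<longrightarrow>
    \<mu>h = discrete_measure N w x \<longrightarrow>
    prob_space \<mu>h \<longrightarrow>
    F = laguerre_cell Y N x \<phi>h \<longrightarrow>
    (\<forall>i\<in>{1..N}. emeasure \<nu> (F i) = ennreal (w i)) \<longrightarrow>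
    semidiscrete_map \<nu> Y N x \<phi>h S \<longrightarrow>
    \<gamma>h = semidiscrete_plan \<nu> S \<longrightarrow>
      (\<integral>\<^sup>+ p \<in> X \<times> Y. ennreal ((norm (T (fst p) - snd p))\<^sup>2) \<partial>\<gamma>h)
        = (\<Sum>i=1..N. \<integral>\<^sup>+ y \<in> F i. ennreal ((norm (T (x i) - y))\<^sup>2 * g y) \<partial>lborel)
    \<and> (\<integral>\<^sup>+ p \<in> X \<times> Y. ennreal ((norm (T (fst p) - snd p))\<^sup>2) \<partial>\<gamma>h)
        \<le> ennreal ((error_bound lam \<mu> \<nu> \<mu>h)\<^sup>2)
    \<and> (\<forall>h. 0 < h \<and> h \<le> 1 / lam \<and> W2 \<mu> \<mu>h \<le> h \<longrightarrow>
          (\<integral>\<^sup>+ p \<in> X \<times> Y. ennreal ((norm (T (fst p) - snd p))\<^sup>2) \<partial>\<gamma>h)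
            \<le> ennreal (C * lam * h))"
proof (intro exI[of _ 1] allI impI)
  fix f g lam \<phi> X Y N w \<phi>h S T
    and x :: "nat \<Rightarrow> 'a" and \<mu>h :: "'a measure" and F :: "nat \<Rightarrow> 'a set"
    and \<gamma>h :: "('a \<times> 'a) measure"
  assume g: "has_lebesgue_density \<nu> g" and lam: "lam > 0" and reg: "regular lam \<mu> \<nu> \<phi>"
    and T: "T = grad \<phi>" and Y: "Y = {y. g y > 0}"
    and X: "X \<in> sets borel" "\<forall>i\<in>{1..N}. x i \<in> X" and inj: "inj_on x {1..N}"
    and \<mu>h: "\<mu>h = discrete_measure N w x" "prob_space \<mu>h"
    and F: "F = laguerre_cell Y N x \<phi>h" "\<forall>i\<in>{1..N}. emeasure \<nu> (F i) = ennreal (w i)"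
    and S: "semidiscrete_map \<nu> Y N x \<phi>h S" and \<gamma>h: "\<gamma>h = semidiscrete_plan \<nu> S"
  let ?I = "\<integral>\<^sup>+ p \<in> X \<times> Y. ennreal ((norm (T (fst p) - snd p))\<^sup>2) \<partial>\<gamma>h"
  let ?W = "W2 \<mu> \<mu>h"
  \<comment> \<open>With no nodes the discrete measure would be zero rather than a probability
    measure.\<close>
  have "1 \<le> N"
  proof (rule ccontr)
    assume "\<not> 1 \<le> N"
    then have "emeasure \<mu>h UNIV = 0"
      unfolding \<mu>h(1) by (subst emeasure_discrete_measure) auto
    then show False
      using prob_space.emeasure_space_1[OF \<mu>h(2)] by (simp add: \<mu>h(1) discrete_measure_def)
  qed
  have [measurable]: "g \<in> borel_measurable borel" and \<nu>: "\<nu> = density lborel (\<lambda>y. ennreal (g y))"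
    using g by (auto simp: has_lebesgue_density_def)
  have Y_sets: "Y \<in> sets borel"
    unfolding Y by measurable
  have AE_Y: "AE y in \<nu>. y \<in> Y"
    unfolding \<nu> by (subst AE_density) (auto simp: Y)
  have "T \<in> borel_measurable borel"
    using reg by (simp add: T regular_def optimal_transport_map_def transport_maps_def)
  note plan = semidiscrete_plan_integral[OF g Y S inj \<open>1 \<le> N\<close> X(1) X(2) this,
      folded \<gamma>h]
  have bound: "?I \<le> ennreal ((lam * ?W)\<^sup>2)"
    unfolding plan(2) unfolding T \<mu>h(1)
    by (rule semidiscrete_error_W2[OF assms reg lam S inj \<open>1 \<le> N\<close> AE_Y Y_sets F(2)[unfolded F(1)]])
  \<comment> \<open>The last summand of \<open>error_bound\<close> is \<open>lam * ?W\<close> and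
    the other one is nonnegative.\<close>
  have "(lam * ?W)\<^sup>2 \<le> (error_bound lam \<mu> \<nu> \<mu>h)\<^sup>2"
    using lam W2_nonneg[of \<mu> \<mu>h] W2_nonneg[of \<mu> \<nu>]
    by (intro power_mono) (auto simp: error_bound_def)
  then have "?I \<le> ennreal ((error_bound lam \<mu> \<nu> \<mu>h)\<^sup>2)"
    using bound by (meson ennreal_leI order_trans)
  moreover have "?I \<le> ennreal (1 * lam * h)" if h: "0 < h \<and> h \<le> 1 / lam \<and> ?W \<le> h" for h
  proof -
    \<comment> \<open>One factor of the square is bounded by 1, using
      \<open>h \<le> 1 / lam\<close>, and the other by \<open>lam * h\<close>; this is where
      \<open>C = 1\<close> comes from.\<close>
    have "lam * ?W \<le> lam * h" "lam * h \<le> 1" "0 \<le> lam * ?W"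
      using h lam W2_nonneg[of \<mu> \<mu>h] by (auto simp: field_simps)
    then have "(lam * ?W)\<^sup>2 \<le> 1 * lam * h"
      using mult_mono[of "lam * ?W" 1 "lam * ?W" "lam * h"] by (simp add: power2_eq_square)
    then show ?thesis
      using bound by (meson ennreal_leI order_trans)
  qed
  ultimately show "?I = (\<Sum>i=1..N. \<integral>\<^sup>+ y \<in> F i. ennreal ((norm (T (x i) - y))\<^sup>2 * g y) \<partial>lborel)
    \<and> ?I \<le> ennreal ((error_bound lam \<mu> \<nu> \<mu>h)\<^sup>2)
    \<and> (\<forall>h. 0 < h \<and> h \<le> 1 / lam \<and> ?W \<le> h \<longrightarrow> ?I \<le> ennreal (1 * lam * h))"
    using plan(1) by (simp add: F(1))
qed

end
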